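(* Let $0<\mu\le 1$, $h>0$, let $n\ge 1$ be an integer, and put $J=\{0,1,\dots,n\}$. Let $p,q,r:J\to\mathbb{R}$ with $p(t)>0$ and $r(t)>0$ for all $t\in J$. Consider the discrete fractional Sturm-Liouville equation $$\Delta_-^{\mu}\big(p(t)\Delta_+^{\mu}x(t)\big)+q(t)x(t)=\lambda r(t)x(t),\qquad t\in J .$$ Eigenfunctions of this equation corresponding to distinct eigenvalues are orthogonal with respect to the weight $r$: if $u,v$ are eigenfunctions with eigenvalues $\lambda_\alpha\neq\lambda_\beta$ respectively, then $\sum_{s=0}^{n}r(s)u(s)\overline{v(s)}=0$.
   Context: An eigenvalue is a $\lambda\in\mathbb{C}$ for which the equation has a solution $x:J\to\mathbb{C}$ that is not identically zero; such an $x$ is an eigenfunction corresponding to $\lambda$. The (Grünwald-Letnikov) delta left and right fractional differences of order $\mu$ of a function $x:J\to\mathbb{C}$ are, for $t\in J$, $$\Delta_-^{\mu}x(t)=\frac{1}{h^{\mu}}\sum_{s=0}^{t}(-1)^s\frac{\mu(\mu-1)\cdots(\mu-s+1)}{s!}x(t-s),$$ $$\Delta_+^{\mu}x(t)=\frac{1}{h^{\mu}}\sum_{s=0}^{n-t}(-1)^s\frac{\mu(\mu-1)\cdots(\mu-s+1)}{s!}x(t+s),$$ where the coefficient for $s=0$ is $1$. The expression $\Delta_-^{\mu}(p(t)\Delta_+^{\mu}x(t))$ means $\Delta_-^\mu$ applied to the function $t\mapsto p(t)\cdot(\Delta_+^\mu x)(t)$ on $J$. *)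

theory Defs
  imports Complex_Main
begin

text \<open>
  Functions on \<open>J = {0..n}\<close> are rendered as functions on \<^typ>\<open>nat\<close>; below, only their values
  at points of \<open>J\<close> are ever used. The coefficient
  \<open>\<mu> (\<mu> - 1) \<cdots> (\<mu> - s + 1) / s!\<close> is the library's generalised binomial coefficient
  \<open>\<mu> gchoose s\<close>.
\<close>

definition delta_left :: "real \<Rightarrow> real \<Rightarrow> (nat \<Rightarrow> complex) \<Rightarrow> nat \<Rightarrow> complex" where
  "delta_left h \<mu> x t =
     complex_of_real (1 / h powr \<mu>) *
       (\<Sum>s = 0..t. complex_of_real ((-1) ^ s * (\<mu> gchoose s)) * x (t - s))"

definition delta_right :: "real \<Rightarrow> real \<Rightarrow> nat \<Rightarrow> (nat \<Rightarrow> complex) \<Rightarrow> nat \<Rightarrow> complex" where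
  "delta_right h \<mu> n x t =
     complex_of_real (1 / h powr \<mu>) *
       (\<Sum>s = 0..n - t. complex_of_real ((-1) ^ s * (\<mu> gchoose s)) * x (t + s))"

definition fsl_solution ::
  "real \<Rightarrow> real \<Rightarrow> nat \<Rightarrow> (nat \<Rightarrow> real) \<Rightarrow> (nat \<Rightarrow> real) \<Rightarrow> (nat \<Rightarrow> real)
     \<Rightarrow> complex \<Rightarrow> (nat \<Rightarrow> complex) \<Rightarrow> bool" where
  "fsl_solution h \<mu> n p q r lam x \<longleftrightarrow>
     (\<forall>t\<in>{0..n}.
        delta_left h \<mu> (\<lambda>\<tau>. complex_of_real (p \<tau>) * delta_right h \<mu> n x \<tau>) t
          + complex_of_real (q t) * x t
        = lam * complex_of_real (r t) * x t)"

definition fsl_eigenfunction ::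
  "real \<Rightarrow> real \<Rightarrow> nat \<Rightarrow> (nat \<Rightarrow> real) \<Rightarrow> (nat \<Rightarrow> real) \<Rightarrow> (nat \<Rightarrow> real)
     \<Rightarrow> complex \<Rightarrow> (nat \<Rightarrow> complex) \<Rightarrow> bool" where
  "fsl_eigenfunction h \<mu> n p q r lam x \<longleftrightarrow>
     fsl_solution h \<mu> n p q r lam x \<and> (\<exists>t\<in>{0..n}. x t \<noteq> 0)"

end

theory Submission
  imports Defs
begin

text \<open>
  Summation by parts shows that the two fractional differences are adjoint to each other on \<open>J\<close>, so
  the operator on the left of the equation is Hermitian for the standard inner product. Hence
  \<open>\<lambda>\<^sub>\<alpha> \<langle>u, v\<rangle> = cnj \<lambda>\<^sub>\<beta> \<langle>u, v\<rangle>\<close> in the \<open>r\<close>-weighted inner product. Taking \<open>u = v\<close> shows that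
  eigenvalues are real, because \<open>\<langle>u, u\<rangle> > 0\<close>, and then \<open>\<lambda>\<^sub>\<alpha> \<noteq> \<lambda>\<^sub>\<beta>\<close> forces \<open>\<langle>u, v\<rangle> = 0\<close>.
\<close>

text \<open>The pairing is bilinear, without conjugation: both sides are the same double sum over
  pairs of points of J at distance \<open>s\<close>, grouped by the right or by the left
  point.\<close>

lemma delta_left_adjoint:
  "(\<Sum>t = 0..n. delta_left h \<mu> f t * g t) = (\<Sum>t = 0..n. f t * delta_right h \<mu> n g t)"
proof -
  define c where "c s = complex_of_real (1 / h powr \<mu>) * complex_of_real ((-1) ^ s * (\<mu> gchoose s))" for s
  have "(\<Sum>t = 0..n. delta_left h \<mu> f t * g t) = (\<Sum>t = 0..n. \<Sum>s = 0..t. c s * f (t - s) * g t)"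
    by (simp add: delta_left_def c_def sum_distrib_left sum_distrib_right mult_ac)
  also have "\<dots> = (\<Sum>(t, s)\<in>(SIGMA t:{0..n}. {0..t}). c s * f (t - s) * g t)"
    by (simp add: sum.Sigma)
  \<comment> \<open>Substitute \<open>j = t - s\<close>, which is not truncated since
    \<open>s \<le> t\<close>; the bound \<open>t \<le> n\<close> turns into
    \<open>s \<le> n - j\<close>.\<close>
  also have "\<dots> = (\<Sum>(j, s)\<in>(SIGMA j:{0..n}. {0..n - j}). c s * f j * g (j + s))"
    by (rule sum.reindex_bij_witness[where i = "\<lambda>(j, s). (j + s, s)" and j = "\<lambda>(t, s). (t - s, s)"])
      auto
  also have "\<dots> = (\<Sum>t = 0..n. \<Sum>s = 0..n - t. c s * f t * g (t + s))"
    by (simp add: sum.Sigma)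
  also have "\<dots> = (\<Sum>t = 0..n. f t * delta_right h \<mu> n g t)"
    by (simp add: delta_right_def c_def sum_distrib_left mult_ac)
  finally show ?thesis .
qed

lemma cnj_delta_right: "cnj (delta_right h \<mu> n x t) = delta_right h \<mu> n (\<lambda>s. cnj (x s)) t"
  by (simp add: delta_right_def)

text \<open>Pair the equation with an arbitrary \<open>y\<close> and move \<open>delta_left\<close>
  onto \<open>cnj y\<close>. As \<open>p\<close> and \<open>q\<close> are real, the right-hand side
  is a Hermitian form in \<open>x\<close> and \<open>y\<close>.\<close>

lemma fsl_solution_weak_form:
  assumes "fsl_solution h \<mu> n p q r lam x"
  shows "lam * (\<Sum>t = 0..n. complex_of_real (r t) * x t * cnj (y t)) =
    (\<Sum>t = 0..n. complex_of_real (p t) * delta_right h \<mu> n x t * cnj (delta_right h \<mu> n y t))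
      + (\<Sum>t = 0..n. complex_of_real (q t) * x t * cnj (y t))"
proof -
  let ?f = "\<lambda>t. complex_of_real (p t) * delta_right h \<mu> n x t"
  have "lam * (\<Sum>t = 0..n. complex_of_real (r t) * x t * cnj (y t)) =
      (\<Sum>t = 0..n. (lam * complex_of_real (r t) * x t) * cnj (y t))"
    by (simp add: sum_distrib_left mult_ac)
  also have "\<dots> = (\<Sum>t = 0..n. (delta_left h \<mu> ?f t + complex_of_real (q t) * x t) * cnj (y t))"
    using assms by (intro sum.cong) (auto simp: fsl_solution_def)
  also have "\<dots> = (\<Sum>t = 0..n. delta_left h \<mu> ?f t * cnj (y t))
      + (\<Sum>t = 0..n. complex_of_real (q t) * x t * cnj (y t))"
    by (simp add: distrib_right sum.distrib)
  finally show ?thesis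
    by (simp only: delta_left_adjoint cnj_delta_right)
qed

text \<open>Test the equation of \<open>u\<close> with \<open>v\<close> and that of \<open>v\<close>
  with \<open>u\<close>; conjugating the second gives the same right-hand side.\<close>

lemma fsl_solutions_hermitian:
  assumes "fsl_solution h \<mu> n p q r lam_a u" and "fsl_solution h \<mu> n p q r lam_b v"
  shows "lam_a * (\<Sum>t = 0..n. complex_of_real (r t) * u t * cnj (v t)) =
    cnj lam_b * (\<Sum>t = 0..n. complex_of_real (r t) * u t * cnj (v t))"
  using fsl_solution_weak_form[OF assms(1), of v]
    arg_cong[OF fsl_solution_weak_form[OF assms(2), of u], of cnj]
  by (simp add: mult_ac)

lemma fsl_eigenvalue_real:
  assumes "fsl_eigenfunction h \<mu> n p q r lam x"
    and r_pos: "\<And>t. t \<in> {0..n} \<Longrightarrow> r t > 0"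
  shows "cnj lam = lam"
proof -
  from assms(1) obtain t where sol: "fsl_solution h \<mu> n p q r lam x" and t: "t \<in> {0..n}" "x t \<noteq> 0"
    by (auto simp: fsl_eigenfunction_def)
  \<comment> \<open>The term at \<open>t\<close> is positive and all others are nonnegative.\<close>
  have "(\<Sum>s = 0..n. r s * (cmod (x s))\<^sup>2) > 0"
    using t r_pos by (intro sum_pos2[of _ t]) (simp_all add: less_imp_le)
  moreover have "(\<Sum>s = 0..n. complex_of_real (r s) * x s * cnj (x s)) =
      complex_of_real (\<Sum>s = 0..n. r s * (cmod (x s))\<^sup>2)"
    by (simp add: mult.assoc flip: complex_norm_square)
  ultimately have "(\<Sum>s = 0..n. complex_of_real (r s) * x s * cnj (x s)) \<noteq> 0"
    by (simp only: of_real_eq_0_iff)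
  then show ?thesis
    using fsl_solutions_hermitian[OF sol sol] by simp
qed

theorem theorem13:
  fixes \<mu> h :: real and n :: nat
    and p q r :: "nat \<Rightarrow> real"
    and lam_a lam_b :: complex
    and u v :: "nat \<Rightarrow> complex"
  assumes "0 < \<mu>" and "\<mu> \<le> 1" and "h > 0" and "n \<ge> 1"
    and "\<And>t. t \<in> {0..n} \<Longrightarrow> p t > 0"
    and "\<And>t. t \<in> {0..n} \<Longrightarrow> r t > 0"
    and "fsl_eigenfunction h \<mu> n p q r lam_a u"
    and "fsl_eigenfunction h \<mu> n p q r lam_b v"
    and "lam_a \<noteq> lam_b"
  shows "(\<Sum>s = 0..n. complex_of_real (r s) * u s * cnj (v s)) = 0"
proof -
  have "cnj lam_b = lam_b"
    using assms(8,6) by (rule fsl_eigenvalue_real)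
  then have "lam_a * (\<Sum>s = 0..n. complex_of_real (r s) * u s * cnj (v s)) =
      lam_b * (\<Sum>s = 0..n. complex_of_real (r s) * u s * cnj (v s))"
    using fsl_solutions_hermitian[of h \<mu> n p q r lam_a u lam_b v] assms(7,8)
    by (simp add: fsl_eigenfunction_def)
  with assms(9) show ?thesis
    by simp
qed

end
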